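(* Suppose the integer batch length satisfies $\tau \ge \frac{\log(2\sqrt{2}\,\kappa)}{-\log\rho}$. Then Exp3-ISS is finite-gain $l_1$ stable in the following sense: for every initial state $x_0$, every horizon $T$, every disturbance sequence with $\|w_t\|\le w_{\max}$ and every realization of the algorithm's random controller selections, the generated states satisfy $$\sum_{t=0}^T \|x_t\| \le \beta w_{\max}(T+\alpha_1 J) + \alpha_2\,(L_f(1+L_\pi)\kappa)^{\mathbb M}\,\|x_0\| + \alpha_3\,(L_f(1+L_\pi)\kappa)^{\mathbb M}(\beta w_{\max}+\bar\pi_0),$$ where $$\alpha_1=\frac{\kappa}{1-\rho}\cdot\frac{1}{1-\kappa\rho^\tau},\qquad \alpha_2=\alpha_1\,\frac{L_f(1+L_\pi)\kappa}{L_f(1+L_\pi)\kappa-1},\qquad \alpha_3=\alpha_2\left(\frac{L_f(1+L_\pi)\kappa}{1-\kappa\rho^\tau}+L_f(2+L_\pi)\right).$$ Similarly, Exp3-ISS is finite-gain $l_2$ stable in the sense that $$\sum_{t=0}^T\|x_t\|^2 = O\left((L_f(1+L_\pi)\kappa)^{2\mathbb M}\|x_0\|^2+\beta^2w_{\max}^2(T+J)+(L_f(1+L_\pi)\kappa)^{2\mathbb M}(\beta^2w_{\max}^2+\bar\pi_0^2)\right),$$ where the constant hidden in $O(\cdot)$ depends only on $\kappa,\rho,\tau,L_f,L_\pi$.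
   Context: $\|\cdot\|$ is the Euclidean norm. System. $x_{t+1}=f(x_t,u_t,w_t)$ with $x_t\in\mathbb R^n$, $u_t\in\mathbb R^m$, $w_t\in\mathbb R^n$, $\|w_t\|\le w_{\max}$; the disturbance sequence is obliviously adversarial (does not depend on past states and actions). $f$ satisfies $\|f(x,u,w)-f(x',u',w')\|\le L_f(\|x-x'\|+\|u-u'\|+\|w-w'\|)$ and $f(0,0,0)=0$. Candidate controllers. $\pi_1,\dots,\pi_N:\mathbb R^n\to\mathbb R^m$, $\mathcal P_0=\{1,\dots,N\}$; each $\pi_i$ is $L_\pi$-Lipschitz and $\max_i\|\pi_i(0)\|\le\bar\pi_0$. Parameters $\kappa\ge1$, $\rho\in(0,1)$, $\beta\ge 1$ are given, and $L_f\ge1$, $L_\pi\ge1$. - A controller $\pi$ is E-ISS with parameters $(\kappa,\rho,\beta)$ if for every $x_0$ and every sequence with $\|w_t\|\le w_{\max}$ for all $t$, the trajectory $x_{t+1}=f(x_t,\pi(x_t),w_t)$ satisfies $\|x_t\|\le\kappa\rho^t\|x_0\|+\beta w_{\max}$ for all $t\ge 0$. - $\pi$ is $\delta$-ES with parameters $(\kappa,\rho)$ if any two trajectories $x_{t+1}=f(x_t,\pi(x_t),w_t)$, $y_{t+1}=f(y_t,\pi(y_t),w_t)$ driven by the same disturbances (with $\|w_s\|\le w_{\max}$) satisfy $\|x_t-y_t\|\le\kappa\rho^t\|x_0-y_0\|$. It is assumed that at least one $\pi_k$, $k\in\mathcal P_0$, is both E-ISS with parameters $(\kappa,\rho,\beta)$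 and $\delta$-ES with parameters $(\kappa,\rho)$. $\mathbb M$ is the number of candidate controllers that are not E-ISS with parameters $(\kappa,\rho,\beta)$. Costs. Functions $c_t(x,u)$ satisfying $|c_t(x,u)-c_t(x',u')|\le (L_{c1}(\max(\|x\|,\|x'\|)+\max(\|u\|,\|u'\|))+L_{c2})(\|x-x'\|+\|u-u'\|)$ and $0\le c_t(0,0)\le c_0$. Algorithm Exp3-ISS. Inputs: non-increasing $(\eta_j)_{j\ge0}$, an integer $\tau\ge1$, $\kappa,\rho,\beta$. Set $t_0=0$, $\tilde G_{-1}(i)=0$ for all $i$, $p_0$ uniform on $\mathcal P_0$. For batches $j=0,1,2,\dots$: draw $I_j\sim p_j$ from the active set $\mathcal P_j$ (terminate if $\mathcal P_j=\emptyset$) and initialize $\mathcal P_{j+1}=\mathcal P_j$. For $t=t_j,\dots,\min(t_j+\tau-1,T)$: apply $u_t=\pi_{I_j}(x_t)$ and observe $x_{t+1}$ and $c_t(x_t,u_t)$; if $\|x_{t+1}\|>\kappa\rho^{t+1-t_j}\|x_{t_j}\|+\beta w_{\max}$, set $\mathcal P_{j+1}=\mathcal P_j\setminus\{I_j\}$ and end the batch immediately ("Break"). With $t$ the last stage of the batch, set $t_{j+1}=t+1$. Let $g_j=\frac1\tau\sum_{t=t_j}^{t_{j+1}-1}c_t(x_t,u_t)$, $\tilde g_j(i)=\frac{g_j}{p_j(i)}\mathbf 1_{(I_j=i)}$, $\tilde G_j(i)=\tilde G_{j-1}(i)+\tilde g_j(i)$ for $i\in\mathcal P_{j+1}$, and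 $p_{j+1}(i)=\exp(-\eta_j\tilde G_j(i))/\sum_{k\in\mathcal P_{j+1}}\exp(-\eta_j\tilde G_j(k))$ for $i\in\mathcal P_{j+1}$. The run ends after stage $T$. $J$ denotes the number of batches (indices $0,\dots,J-1$), with $t_J=T+1$. *)

theory Defs
  imports "HOL-Probability.Probability"
begin

text \<open>
  Real vectors of dimension \<open>n\<close> are the points of the library's \<^const>\<open>Euclidean_space\<close> \<open>n\<close>, i.e.\ the
  functions \<open>x :: nat \<Rightarrow> real\<close> with \<open>x i = 0\<close> for \<open>i \<ge> n\<close>. A type of dimension \<open>n\<close> will not do: the
  constant of an \<open>O\<close>-bound has to be chosen before, and independently of, the dimensions, and HOL
  cannot quantify over types inside a formula.
\<close>

type_synonym rvec = "nat \<Rightarrow> real"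

abbreviation RR :: "nat \<Rightarrow> rvec set" where
  "RR n \<equiv> topspace (Euclidean_space n)"

abbreviation vnorm :: "nat \<Rightarrow> rvec \<Rightarrow> real" where
  "vnorm n x \<equiv> L2_set x {..<n}"

abbreviation vzero :: rvec where
  "vzero \<equiv> \<lambda>_. 0"

definition bounded_disturbance :: "nat \<Rightarrow> real \<Rightarrow> (nat \<Rightarrow> rvec) \<Rightarrow> bool" where
  "bounded_disturbance n w_max w \<longleftrightarrow> (\<forall>t. w t \<in> RR n \<and> vnorm n (w t) \<le> w_max)"

definition closed_loop ::
  "nat \<Rightarrow> (rvec \<Rightarrow> rvec \<Rightarrow> rvec \<Rightarrow> rvec) \<Rightarrow> (rvec \<Rightarrow> rvec) \<Rightarrow> (nat \<Rightarrow> rvec) \<Rightarrow> (nat \<Rightarrow> rvec) \<Rightarrow> bool" where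
  "closed_loop n f \<pi> w x \<longleftrightarrow> x 0 \<in> RR n \<and> (\<forall>t. x (Suc t) = f (x t) (\<pi> (x t)) (w t))"

definition E_ISS ::
  "nat \<Rightarrow> (rvec \<Rightarrow> rvec \<Rightarrow> rvec \<Rightarrow> rvec) \<Rightarrow> real \<Rightarrow> real \<Rightarrow> real \<Rightarrow> real \<Rightarrow> (rvec \<Rightarrow> rvec) \<Rightarrow> bool" where
  "E_ISS n f w_max \<kappa> \<rho> \<beta> \<pi> \<longleftrightarrow>
     (\<forall>w x. bounded_disturbance n w_max w \<and> closed_loop n f \<pi> w x \<longrightarrow>
        (\<forall>t. vnorm n (x t) \<le> \<kappa> * \<rho> ^ t * vnorm n (x 0) + \<beta> * w_max))"

definition delta_ES ::
  "nat \<Rightarrow> (rvec \<Rightarrow> rvec \<Rightarrow> rvec \<Rightarrow> rvec) \<Rightarrow> real \<Rightarrow> real \<Rightarrow> real \<Rightarrow> (rvec \<Rightarrow> rvec) \<Rightarrow> bool" where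
  "delta_ES n f w_max \<kappa> \<rho> \<pi> \<longleftrightarrow>
     (\<forall>w x y. bounded_disturbance n w_max w \<and> closed_loop n f \<pi> w x \<and> closed_loop n f \<pi> w y \<longrightarrow>
        (\<forall>t. vnorm n (x t - y t) \<le> \<kappa> * \<rho> ^ t * vnorm n (x 0 - y 0)))"

locale control_problem =
  fixes n m :: nat
    and f :: "rvec \<Rightarrow> rvec \<Rightarrow> rvec \<Rightarrow> rvec" and L_f w_max :: real
    and N :: nat and \<pi> :: "nat \<Rightarrow> rvec \<Rightarrow> rvec" and L_\<pi> \<pi>_bar0 :: real
    and \<kappa> \<rho> \<beta> :: real
    and c :: "nat \<Rightarrow> rvec \<Rightarrow> rvec \<Rightarrow> real" and L_c1 L_c2 c_0 :: real
  assumes parameters: "\<kappa> \<ge> 1" "0 < \<rho>" "\<rho> < 1" "\<beta> \<ge> 1" "L_f \<ge> 1" "L_\<pi> \<ge> 1"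
    and f_range: "\<And>x u w. x \<in> RR n \<Longrightarrow> u \<in> RR m \<Longrightarrow> w \<in> RR n \<Longrightarrow> f x u w \<in> RR n"
    and f_lipschitz:
      "\<And>x u w x' u' w'. x \<in> RR n \<Longrightarrow> u \<in> RR m \<Longrightarrow> w \<in> RR n \<Longrightarrow>
         x' \<in> RR n \<Longrightarrow> u' \<in> RR m \<Longrightarrow> w' \<in> RR n \<Longrightarrow>
         vnorm n (f x u w - f x' u' w')
           \<le> L_f * (vnorm n (x - x') + vnorm m (u - u') + vnorm n (w - w'))"
    and f_zero: "f vzero vzero vzero = vzero"
    and \<pi>_range: "\<And>i x. i \<in> {1..N} \<Longrightarrow> x \<in> RR n \<Longrightarrow> \<pi> i x \<in> RR m"
    and \<pi>_lipschitz:
      "\<And>i x x'. i \<in> {1..N} \<Longrightarrow> x \<in> RR n \<Longrightarrow> x' \<in> RR n \<Longrightarrow>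
         vnorm m (\<pi> i x - \<pi> i x') \<le> L_\<pi> * vnorm n (x - x')"
    and \<pi>_zero: "\<And>i. i \<in> {1..N} \<Longrightarrow> vnorm m (\<pi> i vzero) \<le> \<pi>_bar0"
    and stabilizing: "\<exists>k\<in>{1..N}. E_ISS n f w_max \<kappa> \<rho> \<beta> (\<pi> k) \<and> delta_ES n f w_max \<kappa> \<rho> (\<pi> k)"
    and c_lipschitz:
      "\<And>t x u x' u'. x \<in> RR n \<Longrightarrow> u \<in> RR m \<Longrightarrow> x' \<in> RR n \<Longrightarrow> u' \<in> RR m \<Longrightarrow>
         \<bar>c t x u - c t x' u'\<bar>
           \<le> (L_c1 * (max (vnorm n x) (vnorm n x') + max (vnorm m u) (vnorm m u')) + L_c2)
               * (vnorm n (x - x') + vnorm m (u - u'))"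
    and c_zero: "\<And>t. 0 \<le> c t vzero vzero" "\<And>t. c t vzero vzero \<le> c_0"

definition num_non_ISS ::
  "nat \<Rightarrow> (rvec \<Rightarrow> rvec \<Rightarrow> rvec \<Rightarrow> rvec) \<Rightarrow> real \<Rightarrow> nat \<Rightarrow> (nat \<Rightarrow> rvec \<Rightarrow> rvec) \<Rightarrow> real \<Rightarrow> real \<Rightarrow> real \<Rightarrow> nat" where
  "num_non_ISS n f w_max N \<pi> \<kappa> \<rho> \<beta> = card {i \<in> {1..N}. \<not> E_ISS n f w_max \<kappa> \<rho> \<beta> (\<pi> i)}"

definition violation ::
  "nat \<Rightarrow> real \<Rightarrow> real \<Rightarrow> real \<Rightarrow> real \<Rightarrow> (nat \<Rightarrow> rvec) \<Rightarrow> nat \<Rightarrow> nat \<Rightarrow> bool" where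
  "violation n w_max \<kappa> \<rho> \<beta> x t0 t \<longleftrightarrow>
     vnorm n (x (t + 1)) > \<kappa> * \<rho> ^ (t + 1 - t0) * vnorm n (x t0) + \<beta> * w_max"

text \<open>
  One realization of Exp3-ISS up to horizon \<open>T\<close>, for the disturbance sequence \<open>w\<close>. Batch \<open>j < J\<close>
  consists of the stages \<open>ts j, \<dots>, ts (Suc j) - 1\<close>; its controller \<open>I j\<close> may be any
  outcome of positive probability under \<open>p j\<close>. The cumulative loss estimates are shifted by one:
  \<open>G j\<close> is the estimate available before batch \<open>j\<close>, usually written with index \<open>j - 1\<close>.
  The run stops after stage \<open>T\<close>, or prematurely when no active controller is left; in the
  latter case the states after stage \<open>ts J\<close> are unconstrained.
\<close>

locale exp3_iss_run =
  fixes n :: nat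
    and f :: "rvec \<Rightarrow> rvec \<Rightarrow> rvec \<Rightarrow> rvec" and w_max :: real
    and N :: nat and \<pi> :: "nat \<Rightarrow> rvec \<Rightarrow> rvec"
    and \<kappa> \<rho> \<beta> :: real
    and c :: "nat \<Rightarrow> rvec \<Rightarrow> rvec \<Rightarrow> real"
    and \<tau> :: nat and \<eta> :: "nat \<Rightarrow> real"
    and w :: "nat \<Rightarrow> rvec" and T J :: nat
    and ts :: "nat \<Rightarrow> nat" and I :: "nat \<Rightarrow> nat" and P :: "nat \<Rightarrow> nat set" and p :: "nat \<Rightarrow> nat pmf"
    and g :: "nat \<Rightarrow> real" and G :: "nat \<Rightarrow> nat \<Rightarrow> real"
    and x u :: "nat \<Rightarrow> rvec"
  assumes batch_length: "\<tau> \<ge> 1"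
    and learning_rates: "decseq \<eta>"
    and disturbance: "bounded_disturbance n w_max w"
    and init: "x 0 \<in> RR n" "ts 0 = 0" "P 0 = {1..N}" "\<And>i. G 0 i = 0"
      "P 0 \<noteq> {} \<Longrightarrow> p 0 = pmf_of_set (P 0)"
    and running: "\<And>j. j < J \<Longrightarrow> ts j \<le> T" "\<And>j. j < J \<Longrightarrow> P j \<noteq> {}"
    and selection: "\<And>j. j < J \<Longrightarrow> I j \<in> set_pmf (p j)"
    and stage:
      "\<And>j t. j < J \<Longrightarrow> ts j \<le> t \<Longrightarrow> t < ts (Suc j) \<Longrightarrow>
         u t = \<pi> (I j) (x t) \<and> x (Suc t) = f (x t) (u t) (w t)"
    and batch_nonempty: "\<And>j. j < J \<Longrightarrow> ts j < ts (Suc j)"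
    and batch_end:
      "\<And>j t. j < J \<Longrightarrow> ts j \<le> t \<Longrightarrow> t < ts (Suc j) \<Longrightarrow>
         Suc t = ts (Suc j) \<longleftrightarrow>
           violation n w_max \<kappa> \<rho> \<beta> x (ts j) t \<or> t = min (ts j + \<tau> - 1) T"
    and active_update:
      "\<And>j. j < J \<Longrightarrow>
         P (Suc j) = (if violation n w_max \<kappa> \<rho> \<beta> x (ts j) (ts (Suc j) - 1) then P j - {I j} else P j)"
    and batch_cost:
      "\<And>j. j < J \<Longrightarrow> g j = 1 / real \<tau> * (\<Sum>t = ts j..<ts (Suc j). c t (x t) (u t))"
    and loss_update:
      "\<And>j i. j < J \<Longrightarrow> i \<in> P (Suc j) \<Longrightarrow>
         G (Suc j) i = G j i + g j / pmf (p j) i * (if I j = i then 1 else 0)"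
    and prob_update:
      "\<And>j i. j < J \<Longrightarrow> P (Suc j) \<noteq> {} \<Longrightarrow>
         pmf (p (Suc j)) i =
           (if i \<in> P (Suc j)
            then exp (- \<eta> j * G (Suc j) i) / (\<Sum>k\<in>P (Suc j). exp (- \<eta> j * G (Suc j) k))
            else 0)"
    and finish: "ts J = T + 1 \<or> P J = {}"

definition break_gain :: "real \<Rightarrow> real \<Rightarrow> real \<Rightarrow> real" where
  "break_gain L_f L_\<pi> \<kappa> = L_f * (1 + L_\<pi>) * \<kappa>"

definition alpha1 :: "real \<Rightarrow> real \<Rightarrow> nat \<Rightarrow> real" where
  "alpha1 \<kappa> \<rho> \<tau> = \<kappa> / (1 - \<rho>) * (1 / (1 - \<kappa> * \<rho> ^ \<tau>))"

definition alpha2 :: "real \<Rightarrow> real \<Rightarrow> nat \<Rightarrow> real \<Rightarrow> real \<Rightarrow> real" where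
  "alpha2 \<kappa> \<rho> \<tau> L_f L_\<pi> =
     alpha1 \<kappa> \<rho> \<tau> * (break_gain L_f L_\<pi> \<kappa> / (break_gain L_f L_\<pi> \<kappa> - 1))"

definition alpha3 :: "real \<Rightarrow> real \<Rightarrow> nat \<Rightarrow> real \<Rightarrow> real \<Rightarrow> real" where
  "alpha3 \<kappa> \<rho> \<tau> L_f L_\<pi> =
     alpha2 \<kappa> \<rho> \<tau> L_f L_\<pi> * (break_gain L_f L_\<pi> \<kappa> / (1 - \<kappa> * \<rho> ^ \<tau>) + L_f * (2 + L_\<pi>))"

end

theory Submission
  imports Defs
begin

text \<open>
  Write \<open>y j\<close> for the norm of the state at the start of batch \<open>j\<close>, \<open>W = \<beta> * w_max\<close>,
  \<open>q = \<kappa> * \<rho> ^ \<tau>\<close>, and \<open>A = L_f * (1 + L_\<pi>) * \<kappa> \<ge> 2\<close>. A batch is good or broken.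
  Inside either kind no violation occurs before the last stage, so the states obey the decay
  \<open>\<kappa> * \<rho> ^ i * y j + W\<close>. A good batch that is not cut off by the horizon has full length, hence
  \<open>y (j + 1) \<le> q * y j + W\<close>, and the lower bound on \<open>\<tau>\<close> makes this a contraction with \<open>8 * q\<^sup>2 \<le> 1\<close>.
  After a broken batch only the Lipschitz constants control the state, which gives
  \<open>y (j + 1) \<le> A * y j + const\<close>.

  Broken batches are rare: replaying the batch as a closed-loop trajectory shows that a break
  refutes the E-ISS property of the selected controller, and this controller is then removed for
  good. So there are at most \<open>M\<close> breaks, and the stabilizing controller always survives, so the run
  does reach the horizon (\<open>broken_not_E_ISS\<close>, \<open>breaks_le\<close>, \<open>run_completes\<close>).

  What remains concerns real sequences. After \<open>b\<close> breaks the batch starts are at most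
  \<open>A ^ b * (y 0 + D) + W / (1 - q)\<close>, where \<open>D\<close> is the offset that a break adds to the deviation from
  the fixed point \<open>W / (1 - q)\<close> of the good batches (\<open>jump_growth_bound\<close>). For their sum it is enough
  that each good batch pays for itself: \<open>(1 - q) * (y 0 + \<dots> + y (j - 1)) + y j\<close> grows by at most
  \<open>W\<close> in a good batch and by at most \<open>A ^ k * (y 0 + D)\<close> at the \<open>k\<close>-th break (\<open>jump_sum_bound\<close>), and
  the latter contributions form a geometric sum dominated by \<open>A ^ M\<close>. Within each batch the
  states sum to a constant times \<open>y j\<close>, plus \<open>W\<close> per stage (\<open>batched_sum_le\<close>).

  The same two sum lemmas applied to squared norms give the \<open>l\<^sub>2\<close> bound. Squaring the recursion of
  the good batches costs a factor 2, which the margin in \<open>8 * q\<^sup>2 \<le> 1\<close> absorbs. Squaring the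
  recursion of the broken batches would cost a factor 2 for every break and turn \<open>A ^ (2 * M)\<close> into
  \<open>(2 * A\<^sup>2) ^ M\<close>; therefore the growth over breaks is bounded first, without squares, and only
  the resulting bound on the state after a break is squared.
\<close>

section \<open>Sums of sequences that contract except at a few jumps\<close>

lemma square_sum_le: "(a + b)\<^sup>2 \<le> 2 * a\<^sup>2 + 2 * b\<^sup>2" for a b :: real
  using zero_le_power2 [of "a - b"] by (simp add: power2_eq_square algebra_simps)

lemma geometric_partial_sum_le:
  fixes r :: real
  assumes "0 \<le> r" "r < 1"
  shows "(\<Sum>i<n. r ^ i) \<le> 1 / (1 - r)"
  using assms by (simp add: sum_gp_strict divide_right_mono)

lemma growing_geometric_sum_le:
  fixes A :: real
  assumes "1 < A" "b \<le> M"
  shows "(\<Sum>k\<le>b. A ^ k) \<le> A ^ M * (A / (A - 1))"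
proof -
  have "(\<Sum>k\<le>b. A ^ k) = (A ^ Suc b - 1) / (A - 1)"
    using assms(1) geometric_sum [of A "Suc b"] by (simp add: lessThan_Suc_atMost)
  also have "\<dots> \<le> A ^ Suc M / (A - 1)"
  proof (rule divide_right_mono)
    have "A ^ Suc b \<le> A ^ Suc M"
      using assms by (intro power_increasing) auto
    then show "A ^ Suc b - 1 \<le> A ^ Suc M"
      by linarith
  qed (use assms in auto)
  finally show ?thesis
    by (simp add: mult.commute)
qed

text \<open>
  A bound \<open>z \<ge> 0\<close> on the excess of \<open>s\<close> over the fixed point \<open>W / (1 - q)\<close> of the contraction survives a
  contraction step and becomes \<open>A * z + D\<close> in a jump. The sequence
  \<open>A ^ b * (s 0 + D) - D\<close> dominates this recursion because \<open>2 * D \<le> A * D\<close>.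
\<close>

lemma jump_growth_bound:
  fixes s :: "nat \<Rightarrow> real" and b :: "nat \<Rightarrow> nat"
  assumes "0 \<le> q" "q < 1" "2 \<le> A" "0 \<le> W" "0 \<le> D" "0 \<le> s 0" "b 0 = 0"
    and D: "A * (W / (1 - q)) + B \<le> D"
    and step: "\<And>j. j < n \<Longrightarrow>
      (b (Suc j) = b j \<and> s (Suc j) \<le> q * s j + W) \<or>
      (b (Suc j) = Suc (b j) \<and> s (Suc j) \<le> A * s j + B)"
  shows "s n \<le> A ^ b n * (s 0 + D) - D + W / (1 - q)"
  using step
proof (induction n)
  case 0
  have "0 \<le> W / (1 - q)"
    using assms by simp
  then show ?case
    using assms by simp
next
  case (Suc n)
  define z where "z = A ^ b n * (s 0 + D) - D"
  define e where "e = W / (1 - q)"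
  have e: "q * e + W = e"
    using \<open>q < 1\<close> by (simp add: e_def field_simps)
  have "0 \<le> e"
    using assms by (simp add: e_def)
  have "1 * (s 0 + D) \<le> A ^ b n * (s 0 + D)"
    using assms by (intro mult_right_mono one_le_power) auto
  then have "0 \<le> z"
    using assms by (simp add: z_def)
  have IH: "s n \<le> z + e"
    using Suc by (simp add: z_def e_def)
  consider "b (Suc n) = b n" "s (Suc n) \<le> q * s n + W"
    | "b (Suc n) = Suc (b n)" "s (Suc n) \<le> A * s n + B"
    using Suc.prems [of n] by auto
  then show ?case
  proof cases
    case 1
    have "q * s n \<le> q * (z + e)"
      using IH \<open>0 \<le> q\<close> by (rule mult_left_mono)
    moreover have "q * z \<le> z"
      using \<open>0 \<le> z\<close> \<open>q < 1\<close> by (simp add: mult_left_le_one_le assms(1))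
    ultimately have "s (Suc n) \<le> z + e"
      using 1 e by (simp add: distrib_left)
    then show ?thesis
      using 1 by (simp add: z_def e_def)
  next
    case 2
    have "A * s n \<le> A * (z + e)"
      using IH assms by (intro mult_left_mono) auto
    then have "s (Suc n) \<le> A * z + D"
      using 2 D by (simp add: distrib_left e_def)
    also have "A * z + D = A ^ Suc (b n) * (s 0 + D) - A * D + D"
      by (simp add: z_def algebra_simps)
    also have "\<dots> \<le> A ^ Suc (b n) * (s 0 + D) - D"
      using mult_right_mono [OF \<open>2 \<le> A\<close> \<open>0 \<le> D\<close>] by simp
    finally show ?thesis
      using 2 \<open>0 \<le> e\<close> by (simp add: e_def)
  qed
qed

text \<open>
  The left-hand side is a potential: a contraction step raises it by \<open>s (n + 1) - r * s n \<le> V\<close>, and the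
  \<open>k\<close>-th jump by at most \<open>Z k\<close>.
\<close>

lemma jump_sum_bound:
  fixes s Z :: "nat \<Rightarrow> real" and b :: "nat \<Rightarrow> nat"
  assumes "0 \<le> r" "0 \<le> V" "\<And>j. 0 \<le> s j" "s 0 \<le> Z 0" "b 0 = 0"
    and step: "\<And>j. j < n \<Longrightarrow>
      (b (Suc j) = b j \<and> s (Suc j) \<le> r * s j + V) \<or>
      (b (Suc j) = Suc (b j) \<and> s (Suc j) \<le> Z (Suc (b j)))"
  shows "(1 - r) * (\<Sum>j<n. s j) + s n \<le> (\<Sum>k\<le>b n. Z k) + V * real n"
  using step
proof (induction n)
  case 0
  then show ?case
    using assms by simp
next
  case (Suc n)
  have IH: "(1 - r) * (\<Sum>j<n. s j) + s n \<le> (\<Sum>k\<le>b n. Z k) + V * real n"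
    using Suc by simp
  have "0 \<le> r * s n"
    using assms by simp
  then show ?case
    using Suc.prems [of n] IH \<open>0 \<le> V\<close>
    by (auto simp: algebra_simps)
qed

lemma batch_sum_le:
  fixes a :: "nat \<Rightarrow> real"
  assumes "0 \<le> r" "r < 1" "0 \<le> k" "0 \<le> y" "t0 < t1" "a t0 \<le> k * y"
    and decay: "\<And>t. t0 < t \<Longrightarrow> t < t1 \<Longrightarrow> a t \<le> k * r ^ (t - t0) * y + V"
  shows "(\<Sum>t=t0..<t1. a t) \<le> k / (1 - r) * y + V * (real (t1 - t0) - 1)"
proof -
  obtain d where d: "t1 = t0 + Suc d"
    using \<open>t0 < t1\<close> less_iff_Suc_add by auto
  have "(\<Sum>t=t0..<t1. a t) = (\<Sum>i<Suc d. a (t0 + i))"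
    using sum.shift_bounds_nat_ivl [of a 0 t0 "Suc d"]
    by (simp add: d atLeast0LessThan add.commute del: sum.lessThan_Suc sum.op_ivl_Suc)
  also have "\<dots> \<le> (\<Sum>i<Suc d. k * r ^ i * y + (if i = 0 then 0 else V))"
  proof (rule sum_mono)
    show "a (t0 + i) \<le> k * r ^ i * y + (if i = 0 then 0 else V)" if "i \<in> {..<Suc d}" for i
      using that decay [of "t0 + i"] assms(6) by (auto simp: d)
  qed
  also have "\<dots> = k * y * (\<Sum>i<Suc d. r ^ i) + V * real d"
    by (simp add: sum.distrib sum_distrib_left distrib_left sum.lessThan_Suc_shift mult_ac del: sum.lessThan_Suc)
  also have "\<dots> \<le> k * y * (1 / (1 - r)) + V * real d"
    using assms by (intro add_right_mono mult_left_mono geometric_partial_sum_le) auto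
  finally show ?thesis
    by (simp add: d)
qed

text \<open>
  The coefficient of \<open>V\<close> is the number of terms that are not the first of their batch: the first
  term is \<open>a (ts j)\<close> itself and needs no additive slack because \<open>1 \<le> k\<close>.
\<close>

lemma batched_sum_le:
  fixes a :: "nat \<Rightarrow> real" and ts :: "nat \<Rightarrow> nat"
  assumes "0 \<le> r" "r < 1" "1 \<le> k" "\<And>t. 0 \<le> a t" "ts 0 = 0"
    and "\<And>j. j < n \<Longrightarrow> ts j < ts (Suc j)"
    and "\<And>j t. j < n \<Longrightarrow> ts j < t \<Longrightarrow> t < ts (Suc j) \<Longrightarrow>
      a t \<le> k * r ^ (t - ts j) * a (ts j) + V"
  shows "(\<Sum>t<ts n. a t) \<le> k / (1 - r) * (\<Sum>j<n. a (ts j)) + V * (real (ts n) - real n)"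
  using assms(6,7)
proof (induction n)
  case 0
  then show ?case
    using assms by simp
next
  case (Suc n)
  have less: "ts n < ts (Suc n)"
    using Suc.prems by simp
  have "1 * a (ts n) \<le> k * a (ts n)"
    using assms by (intro mult_right_mono) auto
  then have "(\<Sum>t=ts n..<ts (Suc n). a t)
      \<le> k / (1 - r) * a (ts n) + V * (real (ts (Suc n) - ts n) - 1)"
    using Suc.prems less assms by (intro batch_sum_le) auto
  moreover have "(\<Sum>t<ts (Suc n). a t) = (\<Sum>t<ts n. a t) + (\<Sum>t=ts n..<ts (Suc n). a t)"
    using less sum.atLeastLessThan_concat [of 0 "ts n" "ts (Suc n)" a]
    by (simp add: atLeast0LessThan)
  moreover have "(\<Sum>t<ts n. a t) \<le> k / (1 - r) * (\<Sum>j<n. a (ts j)) + V * (real (ts n) - real n)"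
    using Suc by simp
  ultimately show ?case
    using less by (simp add: algebra_simps of_nat_diff)
qed

section \<open>Euclidean norm and batch length\<close>

lemma vnorm_triangle: "vnorm n x \<le> vnorm n (x - y) + vnorm n y"
  using L2_set_triangle_ineq [of "x - y" y "{..<n}"] by (simp add: fun_diff_def)

lemma vnorm_diff_zero [simp]: "vnorm n (x - vzero) = vnorm n x"
  by (simp add: fun_diff_def)

lemma vzero_in_RR: "vzero \<in> RR n"
  by (simp add: topspace_Euclidean_space)

lemma batch_contraction:
  fixes \<kappa> \<rho> :: real
  assumes "\<kappa> > 0" "0 < \<rho>" "\<rho> < 1" and "real \<tau> \<ge> ln (2 * sqrt 2 * \<kappa>) / (- ln \<rho>)"
  shows "8 * (\<kappa> * \<rho> ^ \<tau>)\<^sup>2 \<le> 1"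
proof -
  have "ln (2 * sqrt 2 * \<kappa>) \<le> real \<tau> * (- ln \<rho>)"
    using assms pos_divide_le_eq [of "- ln \<rho>" "ln (2 * sqrt 2 * \<kappa>)" "real \<tau>"] by simp
  then have "ln (2 * sqrt 2 * \<kappa> * \<rho> ^ \<tau>) \<le> 0"
    using assms by (simp add: ln_mult ln_realpow)
  then have "2 * sqrt 2 * \<kappa> * \<rho> ^ \<tau> \<le> 1"
    using assms by (subst (asm) ln_le_zero_iff) auto
  then have "(2 * sqrt 2 * \<kappa> * \<rho> ^ \<tau>)\<^sup>2 \<le> 1"
    using assms by (intro power_le_one) auto
  then show ?thesis
    by (simp add: power_mult_distrib)
qed

section \<open>Runs of the algorithm\<close>

text \<open>
  The factor \<open>2 * \<kappa>\<^sup>2 / (1 - \<rho>\<^sup>2)\<close> bounds the sum of the squared norms over a batch in terms of its first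
  state, \<open>1 / (1 - 2 * q\<^sup>2)\<close> comes from the contraction between batches, \<open>A\<^sup>2 / (A\<^sup>2 - 1)\<close> from the
  geometric sum over the breaks, and \<open>K\<close> is the factor of \<open>\<beta> * w_max + \<pi>_bar0\<close> in the offset that every
  break adds.
\<close>

definition l2_gain :: "real \<Rightarrow> real \<Rightarrow> nat \<Rightarrow> real \<Rightarrow> real \<Rightarrow> real" where
  "l2_gain \<kappa> \<rho> \<tau> L_f L_\<pi> =
     (let q = \<kappa> * \<rho> ^ \<tau>; A = break_gain L_f L_\<pi> \<kappa>; K = A / (1 - q) + L_f * (2 + L_\<pi>)
      in 2 + 2 * \<kappa>\<^sup>2 / (1 - \<rho>\<^sup>2) / (1 - 2 * q\<^sup>2) * (2 + A\<^sup>2 / (A\<^sup>2 - 1) * (2 + 4 * K\<^sup>2)))"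

text \<open>
  The batch length enters the gains only through the contraction factor \<open>q = \<kappa> * \<rho> ^ \<tau>\<close> of a full batch; the
  constant 8 makes room for both \<open>q < 1\<close> and \<open>2 * q\<^sup>2 < 1\<close>, the factor 2 coming from
  \<open>square_sum_le\<close>.
\<close>

locale controlled_run =
  control_problem n m f L_f w_max N \<pi> L_\<pi> \<pi>_bar0 \<kappa> \<rho> \<beta> c L_c1 L_c2 c_0 +
  exp3_iss_run n f w_max N \<pi> \<kappa> \<rho> \<beta> c \<tau> \<eta> w T J ts I P p g G x u
  for n m f L_f w_max N \<pi> L_\<pi> \<pi>_bar0 \<kappa> \<rho> \<beta> c L_c1 L_c2 c_0 \<tau> \<eta> w T J ts I P p g G x u +
  assumes contraction: "8 * (\<kappa> * \<rho> ^ \<tau>)\<^sup>2 \<le> 1"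
begin

abbreviation W where "W \<equiv> \<beta> * w_max"
abbreviation q where "q \<equiv> \<kappa> * \<rho> ^ \<tau>"
abbreviation A where "A \<equiv> break_gain L_f L_\<pi> \<kappa>"
abbreviation y where "y j \<equiv> vnorm n (x (ts j))"
abbreviation M where "M \<equiv> num_non_ISS n f w_max N \<pi> \<kappa> \<rho> \<beta>"
abbreviation broken where "broken j \<equiv> violation n w_max \<kappa> \<rho> \<beta> x (ts j) (ts (Suc j) - 1)"

definition breaks :: "nat \<Rightarrow> nat" where
  "breaks j = card {i. i < j \<and> broken i}"

text \<open>
  The offset of one break, measured from the fixed point \<open>W / (1 - q)\<close> of the good batches; it is
  chosen such that \<open>alpha3\<close> times \<open>W + \<pi>_bar0\<close> is \<open>alpha2\<close> times \<open>D\<close>.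
\<close>

definition D :: real where
  "D = (A / (1 - q) + L_f * (2 + L_\<pi>)) * (W + \<pi>_bar0)"

subsection \<open>Constants\<close>

lemma w_max_nonneg: "0 \<le> w_max"
  using disturbance L2_set_nonneg order_trans unfolding bounded_disturbance_def by blast

lemma W_ge: "0 \<le> W" "w_max \<le> W"
  using w_max_nonneg parameters by (auto simp: mult_le_cancel_right1)

lemma \<pi>_bar0_nonneg: "0 \<le> \<pi>_bar0"
  using stabilizing \<pi>_zero L2_set_nonneg order_trans by blast

lemma q_bounds: "0 \<le> q" "q < 1" "2 * q\<^sup>2 < 1"
proof -
  show "0 \<le> q"
    using parameters by simp
  have "q\<^sup>2 < 1\<^sup>2"
    using contraction by simp
  then show "q < 1"
    using power2_less_imp_less zero_le_one by blast
  show "2 * q\<^sup>2 < 1"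
    using contraction by simp
qed

lemma break_gain_ge_2: "2 \<le> A"
proof -
  have "1 * 2 * 1 \<le> L_f * (1 + L_\<pi>) * \<kappa>"
    using parameters by (intro mult_mono) auto
  then show ?thesis
    by (simp add: break_gain_def)
qed

lemma D_nonneg: "0 \<le> D"
  unfolding D_def using q_bounds break_gain_ge_2 parameters W_ge(1) \<pi>_bar0_nonneg
  by (intro mult_nonneg_nonneg [of "_ + _" "_ + _"] add_nonneg_nonneg divide_nonneg_nonneg) auto

subsection \<open>States, active controllers and breaks\<close>

lemma breaks_0: "breaks 0 = 0"
  by (simp add: breaks_def)

lemma breaks_Suc: "breaks (Suc j) = (if broken j then Suc (breaks j) else breaks j)"
proof -
  have "{i. i < Suc j \<and> broken i} = (if broken j then insert j {i. i < j \<and> broken i} else {i. i < j \<and> broken i})"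
    by (auto simp: less_Suc_eq)
  then show ?thesis
    by (simp add: breaks_def)
qed

lemma active_subset: "j \<le> J \<Longrightarrow> P j \<subseteq> {1..N}"
proof (induction j)
  case (Suc j)
  then show ?case
    using active_update [of j] by (auto split: if_splits)
qed (simp add: init)

lemma selected_active: "j < J \<Longrightarrow> I j \<in> P j"
proof (cases j)
  case 0
  assume "j < J"
  then show ?thesis
    using 0 selection [of j] running(2) [of j] init by simp
next
  case (Suc k)
  assume "j < J"
  then have "pmf (p (Suc k)) (I j) \<noteq> 0" "P (Suc k) \<noteq> {}" "k < J"
    using Suc selection [of j] running(2) [of j] by (auto simp: set_pmf_iff)
  then show ?thesis
    using Suc prob_update [of k "I j"] by (auto split: if_splits)
qed

lemma selected_candidate: "j < J \<Longrightarrow> I j \<in> {1..N}"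
  using selected_active active_subset less_imp_le by blast

lemma state_in_RR_batch:
  assumes "j < J" "x (ts j) \<in> RR n" "ts j + s \<le> ts (Suc j)"
  shows "x (ts j + s) \<in> RR n"
  using assms(3)
proof (induction s)
  case (Suc s)
  have "u (ts j + s) = \<pi> (I j) (x (ts j + s))"
    "x (Suc (ts j + s)) = f (x (ts j + s)) (u (ts j + s)) (w (ts j + s))"
    using stage [OF assms(1), of "ts j + s"] Suc.prems by auto
  then show ?case
    using Suc assms(1) selected_candidate disturbance
    by (auto simp: bounded_disturbance_def intro!: f_range \<pi>_range)
qed (use assms in simp)

lemma state_in_RR_start: "j \<le> J \<Longrightarrow> x (ts j) \<in> RR n"
proof (induction j)
  case (Suc j)
  then show ?case
    using state_in_RR_batch [of j "ts (Suc j) - ts j"] batch_nonempty [of j] by auto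
qed (simp add: init)

lemma state_in_RR: "j < J \<Longrightarrow> ts j \<le> t \<Longrightarrow> t \<le> ts (Suc j) \<Longrightarrow> x t \<in> RR n"
  using state_in_RR_batch [of j "t - ts j"] state_in_RR_start [of j] by auto

lemma one_step_bound:
  assumes "i \<in> {1..N}" "v \<in> RR n" "d \<in> RR n" "vnorm n d \<le> w_max"
  shows "vnorm n (f v (\<pi> i v) d) \<le> L_f * (1 + L_\<pi>) * vnorm n v + L_f * (\<pi>_bar0 + w_max)"
proof -
  have "vnorm m (\<pi> i v) \<le> L_\<pi> * vnorm n v + \<pi>_bar0"
    using vnorm_triangle [where n = m and x = "\<pi> i v" and y = "\<pi> i vzero"] \<pi>_lipschitz [OF assms(1,2) vzero_in_RR]
      \<pi>_zero [OF assms(1)] by simp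
  moreover have "vnorm n (f v (\<pi> i v) d) \<le> L_f * (vnorm n v + vnorm m (\<pi> i v) + vnorm n d)"
    using f_lipschitz [OF assms(2) \<pi>_range [OF assms(1,2)] assms(3) vzero_in_RR vzero_in_RR vzero_in_RR]
    by (simp add: f_zero)
  moreover have "L_f * (vnorm n v + vnorm m (\<pi> i v) + vnorm n d)
      \<le> L_f * (vnorm n v + (L_\<pi> * vnorm n v + \<pi>_bar0) + w_max)"
    using calculation(1) assms(4) parameters by (intro mult_left_mono) auto
  ultimately show ?thesis
    by (simp add: algebra_simps)
qed

text \<open>
  Within the batch the run coincides with the closed loop of \<open>\<pi> (I j)\<close> started at \<open>x (ts j)\<close> and driven
  by the shifted disturbance, which is again bounded. Continued beyond the batch, it is a
  trajectory to which the E-ISS bound applies, and at the last stage it contradicts the violation.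
\<close>

lemma broken_not_E_ISS:
  assumes j: "j < J" and "broken j"
  shows "\<not> E_ISS n f w_max \<kappa> \<rho> \<beta> (\<pi> (I j))"
proof
  assume iss: "E_ISS n f w_max \<kappa> \<rho> \<beta> (\<pi> (I j))"
  define \<xi> where "\<xi> = rec_nat (x (ts j)) (\<lambda>s v. f v (\<pi> (I j) v) (w (ts j + s)))"
  have loop: "closed_loop n f (\<pi> (I j)) (\<lambda>s. w (ts j + s)) \<xi>"
    using state_in_RR_start [of j] j by (simp add: closed_loop_def \<xi>_def)
  have agree: "ts j + s \<le> ts (Suc j) \<Longrightarrow> \<xi> s = x (ts j + s)" for s
  proof (induction s)
    case (Suc s)
    then show ?case
      using stage [OF j, of "ts j + s"] by (simp add: \<xi>_def)
  qed (simp add: \<xi>_def)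
  have "bounded_disturbance n w_max (\<lambda>s. w (ts j + s))"
    using disturbance by (simp add: bounded_disturbance_def)
  then have "vnorm n (\<xi> s) \<le> \<kappa> * \<rho> ^ s * vnorm n (\<xi> 0) + \<beta> * w_max" for s
    using iss loop unfolding E_ISS_def by blast
  from this [of "ts (Suc j) - ts j"] show False
    using agree [of "ts (Suc j) - ts j"] agree [of 0] batch_nonempty [OF j] \<open>broken j\<close>
    by (simp add: violation_def)
qed

lemma E_ISS_stay_active:
  "j \<le> J \<Longrightarrow> i \<in> {1..N} \<Longrightarrow> E_ISS n f w_max \<kappa> \<rho> \<beta> (\<pi> i) \<Longrightarrow> i \<in> P j"
proof (induction j)
  case (Suc j)
  then show ?case
    using active_update [of j] broken_not_E_ISS [of j] by auto
qed (simp add: init)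

text \<open>
  Each break removes the controller that was just selected, and a selected controller is active.
\<close>

lemma breaks_plus_active: "j \<le> J \<Longrightarrow> breaks j + card (P j) = N"
proof (induction j)
  case (Suc j)
  have "finite (P j)"
    using active_subset [of j] Suc.prems finite_subset by auto
  then have "Suc (card (P j - {I j})) = card (P j)"
    using selected_active [of j] Suc.prems by (intro card_Suc_Diff1) auto
  then have "broken j \<Longrightarrow> Suc (card (P (Suc j))) = card (P j)"
    using active_update [of j] Suc.prems by auto
  then show ?case
    using Suc active_update [of j] by (auto simp: breaks_Suc)
qed (simp add: init breaks_0)

lemma breaks_le:
  assumes "j \<le> J"
  shows "breaks j \<le> M"
proof -
  let ?E = "{i \<in> {1..N}. E_ISS n f w_max \<kappa> \<rho> \<beta> (\<pi> i)}"
  have "finite (P j)"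
    using active_subset [OF assms] by (rule finite_subset) simp
  then have "card ?E \<le> card (P j)"
    using E_ISS_stay_active [OF assms] by (intro card_mono) auto
  moreover have "card {1..N} = card ({i \<in> {1..N}. \<not> E_ISS n f w_max \<kappa> \<rho> \<beta> (\<pi> i)} \<union> ?E)"
    by (rule arg_cong [where f = card]) auto
  moreover have "\<dots> = M + card ?E"
    unfolding num_non_ISS_def by (rule card_Un_disjoint) auto
  ultimately show ?thesis
    using breaks_plus_active [OF assms] by simp
qed

text \<open>
  The E-ISS candidate is never removed, so the active set does not run empty before the horizon.
\<close>

lemma run_completes: "ts J = T + 1"
  using finish stabilizing E_ISS_stay_active [of J] by blast

lemma J_pos: "0 < J"
  using run_completes init(2) by (cases J) auto

lemma within_batch:
  assumes "j < J" "ts j < t" "t < ts (Suc j)"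
  shows "vnorm n (x t) \<le> \<kappa> * \<rho> ^ (t - ts j) * y j + W"
proof -
  have "ts j \<le> t - 1" "t - 1 < ts (Suc j)" "Suc (t - 1) = t"
    using assms by auto
  then show ?thesis
    using batch_end [OF assms(1), of "t - 1"] assms by (auto simp: violation_def)
qed

subsection \<open>Recursion between batches\<close>

text \<open>
  The premise \<open>Suc j < J\<close> excludes the last batch: the horizon may cut it short, and then the decay
  over a full batch length is not available.
\<close>

lemma unbroken_step:
  assumes "Suc j < J" "\<not> broken j"
  shows "y (Suc j) \<le> q * y j + W"
proof -
  have less: "ts j < ts (Suc j)" and "ts (Suc j) \<le> T"
    using assms batch_nonempty running(1) by auto
  moreover have "ts (Suc j) - 1 = min (ts j + \<tau> - 1) T"
    using batch_end [of j "ts (Suc j) - 1"] assms less by auto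
  ultimately have "ts (Suc j) - 1 = ts j + \<tau> - 1"
    by linarith
  then have "ts (Suc j) = ts j + \<tau>"
    using less batch_length by simp
  then show ?thesis
    using assms(2) batch_length by (simp add: violation_def not_less)
qed

text \<open>
  The state before the violation still satisfies the bound of the batch, and one arbitrary step
  from there costs at most the Lipschitz constants.
\<close>

lemma broken_step:
  assumes "j < J"
  shows "y (Suc j) \<le> A * y j + L_f * (2 + L_\<pi>) * (W + \<pi>_bar0)"
proof -
  define t where "t = ts (Suc j) - 1"
  have t: "ts j \<le> t" "Suc t = ts (Suc j)"
    using batch_nonempty [OF assms] by (auto simp: t_def)
  have "vnorm n (x t) \<le> \<kappa> * y j + W"
  proof (cases "ts j = t")
    case True
    have "1 * vnorm n (x t) \<le> \<kappa> * vnorm n (x t)"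
      using parameters by (intro mult_right_mono) auto
    then show ?thesis
      using True W_ge by simp
  next
    case False
    have "\<kappa> * \<rho> ^ (t - ts j) * y j \<le> \<kappa> * 1 * y j"
      using parameters by (intro mult_right_mono mult_left_mono power_le_one) auto
    then show ?thesis
      using within_batch [OF assms, of t] t False by simp
  qed
  then have "L_f * (1 + L_\<pi>) * vnorm n (x t) \<le> L_f * (1 + L_\<pi>) * (\<kappa> * y j + W)"
    using parameters by (intro mult_left_mono) auto
  moreover have "y (Suc j) \<le> L_f * (1 + L_\<pi>) * vnorm n (x t) + L_f * (\<pi>_bar0 + w_max)"
    using stage [OF assms t(1)] t
      one_step_bound [OF selected_candidate [OF assms] state_in_RR [OF assms, of t], of "w t"] disturbance
    by (simp add: bounded_disturbance_def)
  moreover have "L_f * (\<pi>_bar0 + w_max) \<le> L_f * (\<pi>_bar0 + W)"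
    using parameters W_ge by (intro mult_left_mono) auto
  moreover have "0 \<le> L_f * (1 + L_\<pi>) * \<pi>_bar0"
    using parameters \<pi>_bar0_nonneg by simp
  ultimately show ?thesis
    by (simp add: break_gain_def algebra_simps)
qed

lemma recovery_le_D: "A * (W / (1 - q)) + L_f * (2 + L_\<pi>) * (W + \<pi>_bar0) \<le> D"
proof -
  have "0 \<le> A / (1 - q) * \<pi>_bar0"
    using break_gain_ge_2 q_bounds \<pi>_bar0_nonneg by simp
  then show ?thesis
    by (simp add: D_def algebra_simps add_divide_distrib)
qed

lemma start_bound:
  assumes "j < J"
  shows "y j \<le> A ^ breaks j * (y 0 + D) - D + W / (1 - q)"
proof (rule jump_growth_bound [where B = "L_f * (2 + L_\<pi>) * (W + \<pi>_bar0)"])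
  show "(breaks (Suc i) = breaks i \<and> y (Suc i) \<le> q * y i + W) \<or>
      (breaks (Suc i) = Suc (breaks i) \<and> y (Suc i) \<le> A * y i + L_f * (2 + L_\<pi>) * (W + \<pi>_bar0))"
    if "i < j" for i
    using that assms unbroken_step [of i] broken_step [of i] by (auto simp: breaks_Suc)
qed (use q_bounds break_gain_ge_2 W_ge D_nonneg breaks_0 recovery_le_D in auto)

text \<open>
  Directly after a break the additive term \<open>W / (1 - q)\<close> is gone: it is absorbed by the \<open>- D\<close> in
  \<open>start_bound\<close>, and the purely geometric bound that is left is the one that can be summed
  over the breaks, also after squaring.
\<close>

lemma start_after_break:
  assumes "j < J"
  shows "y (Suc j) \<le> A ^ Suc (breaks j) * (y 0 + D)"
proof -
  define z where "z = A ^ breaks j * (y 0 + D)"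
  have "A * y j \<le> A * (z - D + W / (1 - q))"
    using start_bound [OF assms] break_gain_ge_2 by (intro mult_left_mono) (auto simp: z_def)
  moreover have "1 * D \<le> A * D"
    using D_nonneg break_gain_ge_2 by (intro mult_right_mono) auto
  ultimately have "y (Suc j) \<le> A * z"
    using broken_step [OF assms] recovery_le_D by (simp add: algebra_simps)
  then show ?thesis
    by (simp add: z_def algebra_simps)
qed

subsection \<open>Sums over the run\<close>

lemma sum_states_le:
  "(\<Sum>t=0..T. vnorm n (x t)) \<le> \<kappa> / (1 - \<rho>) * (\<Sum>j<J. y j) + W * (real T + 1 - real J)"
proof -
  have "(\<Sum>t<ts J. vnorm n (x t)) \<le> \<kappa> / (1 - \<rho>) * (\<Sum>j<J. y j) + W * (real (ts J) - real J)"
    using parameters batch_nonempty within_batch init(2) by (intro batched_sum_le) auto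
  moreover have "{0..T} = {..<ts J}"
    by (auto simp: run_completes)
  ultimately show ?thesis
    by (simp add: run_completes add.commute)
qed

lemma sum_squares_states_le:
  "(\<Sum>t=0..T. (vnorm n (x t))\<^sup>2)
     \<le> 2 * \<kappa>\<^sup>2 / (1 - \<rho>\<^sup>2) * (\<Sum>j<J. (y j)\<^sup>2) + 2 * W\<^sup>2 * (real T + 1 - real J)"
proof -
  have "(\<Sum>t<ts J. (vnorm n (x t))\<^sup>2)
      \<le> 2 * \<kappa>\<^sup>2 / (1 - \<rho>\<^sup>2) * (\<Sum>j<J. (y j)\<^sup>2) + 2 * W\<^sup>2 * (real (ts J) - real J)"
  proof (rule batched_sum_le)
    show "\<rho>\<^sup>2 < 1"
      using parameters by (simp add: power_less_one_iff)
    have "1 \<le> \<kappa>\<^sup>2"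
      using parameters by (simp add: one_le_power)
    then show "1 \<le> 2 * \<kappa>\<^sup>2"
      by simp
    show "(vnorm n (x t))\<^sup>2 \<le> 2 * \<kappa>\<^sup>2 * (\<rho>\<^sup>2) ^ (t - ts j) * (y j)\<^sup>2 + 2 * W\<^sup>2"
      if "j < J" "ts j < t" "t < ts (Suc j)" for j t
    proof -
      have "(vnorm n (x t))\<^sup>2 \<le> (\<kappa> * \<rho> ^ (t - ts j) * y j + W)\<^sup>2"
        using within_batch [OF that] by (intro power_mono) auto
      also have "\<dots> \<le> 2 * (\<kappa> * \<rho> ^ (t - ts j) * y j)\<^sup>2 + 2 * W\<^sup>2"
        by (rule square_sum_le)
      finally show ?thesis
        by (simp only: power_mult_distrib power_mult [symmetric] mult.commute [of 2] mult.assoc)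
    qed
  qed (use init(2) batch_nonempty in auto)
  moreover have "{0..T} = {..<ts J}"
    by (auto simp: run_completes)
  ultimately show ?thesis
    by (simp add: run_completes add.commute)
qed

lemma sum_starts_le:
  "(1 - q) * (\<Sum>j<J. y j) \<le> A ^ M * (A / (A - 1)) * (y 0 + D) + W * real J"
proof -
  \<comment> \<open>The recursion is followed up to the start of the last batch, which the horizon may cut short; the
    potential there already contains the last summand in full.\<close>
  obtain k where k: "J = Suc k"
    using J_pos gr0_implies_Suc by blast
  have "(1 - q) * (\<Sum>j<k. y j) + y k \<le> (\<Sum>i\<le>breaks k. A ^ i * (y 0 + D)) + W * real k"
  proof (rule jump_sum_bound)
    show "(breaks (Suc j) = breaks j \<and> y (Suc j) \<le> q * y j + W) \<or>
        (breaks (Suc j) = Suc (breaks j) \<and> y (Suc j) \<le> A ^ Suc (breaks j) * (y 0 + D))"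
      if "j < k" for j
      using that k unbroken_step [of j] start_after_break [of j] by (auto simp: breaks_Suc)
  qed (use q_bounds W_ge D_nonneg breaks_0 in auto)
  moreover have "(\<Sum>i\<le>breaks k. A ^ i * (y 0 + D)) \<le> A ^ M * (A / (A - 1)) * (y 0 + D)"
    unfolding sum_distrib_right [symmetric]
    using break_gain_ge_2 D_nonneg breaks_le [of k] k
    by (intro mult_right_mono growing_geometric_sum_le) auto
  moreover have "0 \<le> q * y k"
    using q_bounds by simp
  ultimately show ?thesis
    using W_ge by (simp add: k algebra_simps)
qed

lemma sum_squares_starts_le:
  "(1 - 2 * q\<^sup>2) * (\<Sum>j<J. (y j)\<^sup>2)
     \<le> A ^ (2 * M) * (A\<^sup>2 / (A\<^sup>2 - 1)) * (y 0 + D)\<^sup>2 + 2 * W\<^sup>2 * real J"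
proof -
  obtain k where k: "J = Suc k"
    using J_pos gr0_implies_Suc by blast
  have "(1 - 2 * q\<^sup>2) * (\<Sum>j<k. (y j)\<^sup>2) + (y k)\<^sup>2
      \<le> (\<Sum>i\<le>breaks k. (A\<^sup>2) ^ i * (y 0 + D)\<^sup>2) + 2 * W\<^sup>2 * real k"
  proof (rule jump_sum_bound)
    show "(breaks (Suc j) = breaks j \<and> (y (Suc j))\<^sup>2 \<le> 2 * q\<^sup>2 * (y j)\<^sup>2 + 2 * W\<^sup>2) \<or>
        (breaks (Suc j) = Suc (breaks j) \<and> (y (Suc j))\<^sup>2 \<le> (A\<^sup>2) ^ Suc (breaks j) * (y 0 + D)\<^sup>2)"
      if "j < k" for j
    proof (cases "broken j")
      case True
      \<comment> \<open>Squaring the accumulated bound rather than the recursion keeps the growth at \<open>A\<^sup>2\<close> per break.\<close>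
      have "(y (Suc j))\<^sup>2 \<le> (A ^ Suc (breaks j) * (y 0 + D))\<^sup>2"
        using start_after_break [of j] that k by (intro power_mono) auto
      also have "\<dots> = (A\<^sup>2) ^ Suc (breaks j) * (y 0 + D)\<^sup>2"
        by (simp only: power_mult_distrib power_mult [symmetric] mult.commute [of 2])
      finally show ?thesis
        using True by (simp only: breaks_Suc if_True simp_thms)
    next
      case False
      have "(y (Suc j))\<^sup>2 \<le> (q * y j + W)\<^sup>2"
        using unbroken_step [of j] that k False by (intro power_mono) auto
      also have "\<dots> \<le> 2 * (q * y j)\<^sup>2 + 2 * W\<^sup>2"
        by (rule square_sum_le)
      finally show ?thesis
        using False by (simp add: breaks_Suc power_mult_distrib mult_ac)
    qed
    show "(y 0)\<^sup>2 \<le> (A\<^sup>2) ^ 0 * (y 0 + D)\<^sup>2"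
      using D_nonneg by (simp add: power_mono)
  qed (use breaks_0 in auto)
  moreover have "(\<Sum>i\<le>breaks k. (A\<^sup>2) ^ i * (y 0 + D)\<^sup>2) \<le> (A\<^sup>2) ^ M * (A\<^sup>2 / (A\<^sup>2 - 1)) * (y 0 + D)\<^sup>2"
    unfolding sum_distrib_right [symmetric]
    using break_gain_ge_2 breaks_le [of k] k
    by (intro mult_right_mono growing_geometric_sum_le) (auto simp: one_less_power)
  moreover have "0 \<le> 2 * q\<^sup>2 * (y k)\<^sup>2" "0 \<le> 2 * W\<^sup>2"
    by auto
  ultimately show ?thesis
    unfolding k power_mult by (simp only: sum.lessThan_Suc distrib_left left_diff_distrib of_nat_Suc)
qed

lemma l1_stable:
  "(\<Sum>t=0..T. vnorm n (x t))
     \<le> W * (real T + alpha1 \<kappa> \<rho> \<tau> * real J)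
       + alpha2 \<kappa> \<rho> \<tau> L_f L_\<pi> * A ^ M * vnorm n (x 0)
       + alpha3 \<kappa> \<rho> \<tau> L_f L_\<pi> * A ^ M * (W + \<pi>_bar0)"
proof -
  have k: "0 \<le> \<kappa> / (1 - \<rho>)"
    using parameters by simp
  have "(\<Sum>j<J. y j) \<le> (A ^ M * (A / (A - 1)) * (y 0 + D) + W * real J) / (1 - q)"
    using sum_starts_le q_bounds by (simp add: pos_le_divide_eq mult.commute)
  from mult_left_mono [OF this k]
  have "\<kappa> / (1 - \<rho>) * (\<Sum>j<J. y j)
      \<le> alpha2 \<kappa> \<rho> \<tau> L_f L_\<pi> * A ^ M * (y 0 + D) + alpha1 \<kappa> \<rho> \<tau> * W * real J"
    by (simp add: alpha1_def alpha2_def add_divide_distrib distrib_left mult_ac)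
  moreover have "W * (real T + 1 - real J) \<le> W * real T"
    using W_ge J_pos by (intro mult_left_mono) auto
  moreover have "alpha3 \<kappa> \<rho> \<tau> L_f L_\<pi> * A ^ M * (W + \<pi>_bar0) = alpha2 \<kappa> \<rho> \<tau> L_f L_\<pi> * A ^ M * D"
    by (simp add: alpha3_def D_def)
  ultimately show ?thesis
    using sum_states_le by (simp add: init(2) algebra_simps)
qed

lemma l2_stable:
  "(\<Sum>t=0..T. (vnorm n (x t))\<^sup>2)
     \<le> l2_gain \<kappa> \<rho> \<tau> L_f L_\<pi> *
         (A ^ (2 * M) * (vnorm n (x 0))\<^sup>2 + \<beta>\<^sup>2 * w_max\<^sup>2 * (real T + real J)
           + A ^ (2 * M) * (\<beta>\<^sup>2 * w_max\<^sup>2 + \<pi>_bar0\<^sup>2))"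
proof -
  define E where "E = 2 * \<kappa>\<^sup>2 / (1 - \<rho>\<^sup>2) / (1 - 2 * q\<^sup>2)"
  define H where "H = A\<^sup>2 / (A\<^sup>2 - 1)"
  define K where "K = A / (1 - q) + L_f * (2 + L_\<pi>)"
  define X where "X = A ^ (2 * M) * ((y 0)\<^sup>2 + (W\<^sup>2 + \<pi>_bar0\<^sup>2))"
  define Y where "Y = W\<^sup>2 * (real T + real J)"
  have rho: "\<rho>\<^sup>2 < 1" and "1 < A\<^sup>2"
    using parameters break_gain_ge_2 by (auto simp: power_less_one_iff one_less_power)
  then have "0 \<le> H"
    by (simp add: H_def)
  have k: "0 \<le> 2 * \<kappa>\<^sup>2 / (1 - \<rho>\<^sup>2)"
    using rho by simp
  have "0 \<le> E"
    unfolding E_def using rho q_bounds by (intro divide_nonneg_nonneg) auto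
  have "0 \<le> X" "0 \<le> Y"
    using break_gain_ge_2 by (auto simp: X_def Y_def)
  define S where "S = W\<^sup>2 + \<pi>_bar0\<^sup>2"
  have "(W + \<pi>_bar0)\<^sup>2 \<le> 2 * S"
    using square_sum_le [of W \<pi>_bar0] by (simp only: S_def distrib_left)
  then have "D\<^sup>2 \<le> K\<^sup>2 * (2 * S)"
    unfolding D_def K_def power_mult_distrib [of "_ + _" "_ + _"] by (intro mult_left_mono) auto
  moreover have "(y 0 + D)\<^sup>2 \<le> 2 * (y 0)\<^sup>2 + 2 * D\<^sup>2"
    by (rule square_sum_le)
  moreover have "0 \<le> K\<^sup>2 * (y 0)\<^sup>2" "0 \<le> S"
    by (auto simp: S_def)
  ultimately have "(y 0 + D)\<^sup>2 \<le> (2 + 4 * K\<^sup>2) * ((y 0)\<^sup>2 + S)"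
    by (simp only: distrib_left distrib_right)
  then have "(y 0 + D)\<^sup>2 \<le> (2 + 4 * K\<^sup>2) * ((y 0)\<^sup>2 + (W\<^sup>2 + \<pi>_bar0\<^sup>2))"
    by (simp only: S_def)
  then have "A ^ (2 * M) * H * (y 0 + D)\<^sup>2
      \<le> A ^ (2 * M) * H * ((2 + 4 * K\<^sup>2) * ((y 0)\<^sup>2 + (W\<^sup>2 + \<pi>_bar0\<^sup>2)))"
    using \<open>0 \<le> H\<close> break_gain_ge_2 by (intro mult_left_mono) auto
  also have "\<dots> = H * (2 + 4 * K\<^sup>2) * X"
    by (simp add: X_def mult_ac)
  finally have "(1 - 2 * q\<^sup>2) * (\<Sum>j<J. (y j)\<^sup>2) \<le> H * (2 + 4 * K\<^sup>2) * X + 2 * W\<^sup>2 * real J"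
    using sum_squares_starts_le by (simp add: H_def)
  then have "(\<Sum>j<J. (y j)\<^sup>2) \<le> (H * (2 + 4 * K\<^sup>2) * X + 2 * W\<^sup>2 * real J) / (1 - 2 * q\<^sup>2)"
    using q_bounds by (simp add: pos_le_divide_eq mult.commute)
  from mult_left_mono [OF this k]
  have "2 * \<kappa>\<^sup>2 / (1 - \<rho>\<^sup>2) * (\<Sum>j<J. (y j)\<^sup>2) \<le> E * (H * (2 + 4 * K\<^sup>2) * X + 2 * W\<^sup>2 * real J)"
    by (simp add: E_def)
  also have "\<dots> \<le> E * (H * (2 + 4 * K\<^sup>2) * X + 2 * Y)"
    using \<open>0 \<le> E\<close> by (intro mult_left_mono) (auto simp: Y_def distrib_left)
  finally have "(\<Sum>t=0..T. (vnorm n (x t))\<^sup>2)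
      \<le> E * (H * (2 + 4 * K\<^sup>2) * X + 2 * Y) + 2 * W\<^sup>2 * (real T + 1 - real J)"
    using sum_squares_states_le by simp
  also have "2 * W\<^sup>2 * (real T + 1 - real J) \<le> 2 * W\<^sup>2 * (real T + real J)"
    using J_pos by (intro mult_left_mono) auto
  also have "\<dots> = 2 * Y"
    by (simp add: Y_def)
  also have "E * (H * (2 + 4 * K\<^sup>2) * X + 2 * Y) + 2 * Y
      \<le> E * (H * (2 + 4 * K\<^sup>2) * X + 2 * Y) + 2 * Y + (2 * X + E * (2 * X) + E * (H * (2 + 4 * K\<^sup>2)) * Y)"
    using \<open>0 \<le> E\<close> \<open>0 \<le> H\<close> \<open>0 \<le> X\<close> \<open>0 \<le> Y\<close> by simp
  also have "\<dots> = (2 + E * (2 + H * (2 + 4 * K\<^sup>2))) * (X + Y)"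
    by (simp add: distrib_left distrib_right mult_ac)
  also have "2 + E * (2 + H * (2 + 4 * K\<^sup>2)) = l2_gain \<kappa> \<rho> \<tau> L_f L_\<pi>"
    by (simp add: l2_gain_def Let_def E_def H_def K_def)
  finally show ?thesis
    by (simp add: X_def Y_def init(2) power_mult_distrib distrib_left add_ac)
qed

lemma l2_gain_pos: "0 < l2_gain \<kappa> \<rho> \<tau> L_f L_\<pi>"
proof -
  have "\<rho>\<^sup>2 < 1" "1 < (break_gain L_f L_\<pi> \<kappa>)\<^sup>2"
    using parameters break_gain_ge_2 by (auto simp: power_less_one_iff one_less_power)
  then show ?thesis
    unfolding l2_gain_def Let_def using q_bounds
    by (intro add_pos_nonneg mult_nonneg_nonneg divide_nonneg_nonneg add_nonneg_nonneg) auto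
qed

end

section \<open>Finite-gain stability\<close>

theorem theorem9:
  fixes \<kappa> \<rho> L_f L_\<pi> :: real and \<tau> :: nat
  assumes "real \<tau> \<ge> ln (2 * sqrt 2 * \<kappa>) / (- ln \<rho>)"
  shows "(\<forall>n m f w_max N \<pi> \<pi>_bar0 \<beta> c L_c1 L_c2 c_0 \<eta> w T J ts I P p g G x u.
            control_problem n m f L_f w_max N \<pi> L_\<pi> \<pi>_bar0 \<kappa> \<rho> \<beta> c L_c1 L_c2 c_0 \<and>
            exp3_iss_run n f w_max N \<pi> \<kappa> \<rho> \<beta> c \<tau> \<eta> w T J ts I P p g G x u \<longrightarrow>
              (let A = break_gain L_f L_\<pi> \<kappa>; M = num_non_ISS n f w_max N \<pi> \<kappa> \<rho> \<beta> in
                (\<Sum>t=0..T. vnorm n (x t))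
                  \<le> \<beta> * w_max * (real T + alpha1 \<kappa> \<rho> \<tau> * real J)
                    + alpha2 \<kappa> \<rho> \<tau> L_f L_\<pi> * A ^ M * vnorm n (x 0)
                    + alpha3 \<kappa> \<rho> \<tau> L_f L_\<pi> * A ^ M * (\<beta> * w_max + \<pi>_bar0)))
       \<and> (\<exists>C>0. \<forall>n m f w_max N \<pi> \<pi>_bar0 \<beta> c L_c1 L_c2 c_0 \<eta> w T J ts I P p g G x u.
            control_problem n m f L_f w_max N \<pi> L_\<pi> \<pi>_bar0 \<kappa> \<rho> \<beta> c L_c1 L_c2 c_0 \<and>
            exp3_iss_run n f w_max N \<pi> \<kappa> \<rho> \<beta> c \<tau> \<eta> w T J ts I P p g G x u \<longrightarrow>
              (let A = break_gain L_f L_\<pi> \<kappa>; M = num_non_ISS n f w_max N \<pi> \<kappa> \<rho> \<beta> in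
                (\<Sum>t=0..T. (vnorm n (x t))\<^sup>2)
                  \<le> C * (A ^ (2 * M) * (vnorm n (x 0))\<^sup>2
                         + \<beta>\<^sup>2 * w_max\<^sup>2 * (real T + real J)
                         + A ^ (2 * M) * (\<beta>\<^sup>2 * w_max\<^sup>2 + \<pi>_bar0\<^sup>2))))"
proof -
  have run: "controlled_run n m f L_f w_max N \<pi> L_\<pi> \<pi>_bar0 \<kappa> \<rho> \<beta> c L_c1 L_c2 c_0 \<tau> \<eta> w T J ts I P p g G x u"
    if "control_problem n m f L_f w_max N \<pi> L_\<pi> \<pi>_bar0 \<kappa> \<rho> \<beta> c L_c1 L_c2 c_0"
      and "exp3_iss_run n f w_max N \<pi> \<kappa> \<rho> \<beta> c \<tau> \<eta> w T J ts I P p g G x u"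
    for n m f w_max N \<pi> \<pi>_bar0 \<beta> c L_c1 L_c2 c_0 \<eta> w T J ts I P p g G x u
  proof -
    interpret control_problem n m f L_f w_max N \<pi> L_\<pi> \<pi>_bar0 \<kappa> \<rho> \<beta> c L_c1 L_c2 c_0
      by fact
    have "8 * (\<kappa> * \<rho> ^ \<tau>)\<^sup>2 \<le> 1"
      using parameters assms by (intro batch_contraction) auto
    with that show ?thesis
      by (intro controlled_run.intro controlled_run_axioms.intro)
  qed
  \<comment> \<open>For parameters outside the admissible range \<open>l2_gain\<close> need not be positive; there is no control problem
    with such parameters, so 1 serves as the constant.\<close>
  define C where "C = (if 0 < l2_gain \<kappa> \<rho> \<tau> L_f L_\<pi> then l2_gain \<kappa> \<rho> \<tau> L_f L_\<pi> else 1)"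
  have C_eq: "C = l2_gain \<kappa> \<rho> \<tau> L_f L_\<pi>"
    if "control_problem n m f L_f w_max N \<pi> L_\<pi> \<pi>_bar0 \<kappa> \<rho> \<beta> c L_c1 L_c2 c_0"
      and "exp3_iss_run n f w_max N \<pi> \<kappa> \<rho> \<beta> c \<tau> \<eta> w T J ts I P p g G x u"
    for n m f w_max N \<pi> \<pi>_bar0 \<beta> c L_c1 L_c2 c_0 \<eta> w T J ts I P p g G x u
    using controlled_run.l2_gain_pos [OF run [OF that]] by (simp add: C_def)
  show ?thesis
    unfolding Let_def
  proof (intro conjI exI [of _ C] allI impI; (elim conjE)?)
    show "0 < C"
      by (simp add: C_def)
  qed (rule controlled_run.l1_stable [OF run], assumption+,
      subst C_eq, assumption+, rule controlled_run.l2_stable [OF run], assumption+)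
qed

end
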